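(* Let $X,Y$ be finite dimensional normed spaces, $F_i:X\rightrightarrows Y$, $i=1,\dots,p$, closed-graph set-valued mappings, $(\overline{x},\overline{y}_i)\in\operatorname{Gr}F_i$ for $i=1,\dots,p$, and $u\in S_Y$. Assume that the sets $$D_i:=\{(x,y_1,\dots,y_p)\in X\times Y^p\mid y_i\in F_i(x)\},\quad i=1,\dots,p,$$ are allied at $(\overline{x},\overline{y}_1,\dots,\overline{y}_p)$, and that there exist $c>0$ and $r>0$ such that for every $(u_i,v_i)\in\operatorname{Gr}F_i\cap[B(\overline{x},r)\times B(\overline{y}_i,r)]$, $i=1,\dots,p$, every $y^{\ast}\in Y^{\ast}$ with $\langle y^{\ast},u\rangle=1$, every $z_i^{\ast}\in 2cB_{Y^{\ast}}$, $i=2,\dots,p$, every $x_1^{\ast}\in\widehat{D}^{\ast}F_1(u_1,v_1)(y^{\ast})$ and every $x_i^{\ast}\in\widehat{D}^{\ast}F_i(u_i,v_i)(y^{\ast}-z_i^{\ast})$, $i=2,\dots,p$, one has $$c\leq\|x_1^{\ast}+\dots+x_p^{\ast}\|.$$ Then for every $a\in(0,c)$, the mapping $H:X\rightrightarrows Y$, $H(x):=\sum_{i=1}^{p}F_i(x)$, is directionally (linearly) open at $(\overline{x},\overline{y}_1+\dots+\overline{y}_p)\in\operatorname{Gr}H$ with respect to $\{u\}$ with modulus $a$.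
   Context: $B(x,r)$ is the open ball, $S_Y$ the unit sphere of $Y$, $B_{Y^{\ast}}$ the open unit ball of the dual $Y^{\ast}$; $\operatorname{Gr}F=\{(x,y)\mid y\in F(x)\}$, $\operatorname{cone}\{u\}=\{tu\mid t\ge0\}$; $H(x)$ is a Minkowski sum (empty if a summand is empty), and the image of a set is the union of the images of its points. Fréchet normal cone: for $x\in S$, $\widehat{N}(S,x):=\{x^{\ast}\mid\limsup_{u\to x,\,u\in S}\frac{\langle x^{\ast},u-x\rangle}{\|u-x\|}\le0\}$; $\widehat N(S,x):=\emptyset$ if $x\notin S$. Fréchet coderivative of $F$ at $(x,y)\in\operatorname{Gr}F$: $\widehat{D}^{\ast}F(x,y)(y^{\ast}):=\{x^{\ast}\in X^{\ast}\mid(x^{\ast},-y^{\ast})\in\widehat{N}(\operatorname{Gr}F,(x,y))\}$. Alliedness: subsets $S_1,\dots,S_p$ of a normed space, closed around $\overline{z}\in S_1\cap\dots\cap S_p$, are allied at $\overline{z}$ if for all sequences $z_{in}\to\overline{z}$ with $z_{in}\in S_i$ and $z_{in}^{\ast}\in\widehat{N}(S_i,z_{in})$, $i=1,\dots,p$, the relation $z_{1n}^{\ast}+\dots+z_{pn}^{\ast}\to0$ implies $z_{in}^{\ast}\to0$ for every $i=1,\dots,p$. Directional openness: a set-valued mapping $F$ is directionally linearly open at $(\overline{x},\overline{y})\in\operatorname{Gr}F$ with respect to $\{u\}$ with modulus $\alpha>0$ if there is $\varepsilon>0$ such that for every $\rho\in(0,\varepsilon)$, $B(\overline{y},\alpha\rho)\cap[\overline{y}-\operatorname{cone}\{u\}]\subseteq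 F(B(\overline{x},\rho))$. *)

theory Defs
  imports "HOL-Analysis.Analysis"
begin

text \<open>The topological dual of a normed space is the type of bounded linear functionals
  \<open>'a \<Rightarrow>\<^sub>L real\<close> with its operator norm.\<close>

definition graph_sv :: "('a \<Rightarrow> 'b set) \<Rightarrow> ('a \<times> 'b) set" where
  "graph_sv F = {(x, y). y \<in> F x}"

text \<open>\<open>at x within S\<close> excludes \<open>x\<close> itself, so there is no division by zero; at an isolated
  point of \<open>S\<close> the upper limit is \<open>-\<infinity>\<close> and the cone is the whole dual. The cone does not
  change when the norm is replaced by an equivalent one, so the Euclidean combination of norms
  that the library puts on products is as good as any other product norm.\<close>

definition frechet_normal_cone :: "'a::real_normed_vector set \<Rightarrow> 'a \<Rightarrow> ('a \<Rightarrow>\<^sub>L real) set" where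
  "frechet_normal_cone S x =
     (if x \<in> S
      then {xs. Limsup (at x within S)
                  (\<lambda>u. ereal (blinfun_apply xs (u - x) / norm (u - x))) \<le> 0}
      else {})"

text \<open>The pair \<open>(x\<^sup>*, y\<^sup>*)\<close> of functionals, as a functional on the product space.\<close>

definition dual_pair ::
  "('a::real_normed_vector \<Rightarrow>\<^sub>L real) \<Rightarrow> ('b::real_normed_vector \<Rightarrow>\<^sub>L real) \<Rightarrow> ('a \<times> 'b) \<Rightarrow>\<^sub>L real" where
  "dual_pair xs ys = (xs o\<^sub>L fst_blinfun) + (ys o\<^sub>L snd_blinfun)"

definition frechet_coderivative ::
  "('a::real_normed_vector \<Rightarrow> 'b::real_normed_vector set) \<Rightarrow> 'a \<Rightarrow> 'b
     \<Rightarrow> ('b \<Rightarrow>\<^sub>L real) \<Rightarrow> ('a \<Rightarrow>\<^sub>L real) set" where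
  "frechet_coderivative F x y ys =
     {xs. dual_pair xs (- ys) \<in> frechet_normal_cone (graph_sv F) (x, y)}"

definition closed_around :: "'a::metric_space set \<Rightarrow> 'a \<Rightarrow> bool" where
  "closed_around S z \<longleftrightarrow> (\<exists>r>0. closed (S \<inter> cball z r))"

definition allied :: "('i::finite \<Rightarrow> 'a::real_normed_vector set) \<Rightarrow> 'a \<Rightarrow> bool" where
  "allied S z \<longleftrightarrow>
     (\<forall>i. z \<in> S i \<and> closed_around (S i) z) \<and>
     (\<forall>(w :: 'i \<Rightarrow> nat \<Rightarrow> 'a) (ws :: 'i \<Rightarrow> nat \<Rightarrow> ('a \<Rightarrow>\<^sub>L real)).
        (\<forall>i. w i \<longlonglongrightarrow> z) \<longrightarrow>
        (\<forall>i n. w i n \<in> S i \<and> ws i n \<in> frechet_normal_cone (S i) (w i n)) \<longrightarrow>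
        (\<lambda>n. \<Sum>i\<in>UNIV. ws i n) \<longlonglongrightarrow> 0 \<longrightarrow>
        (\<forall>i. ws i \<longlonglongrightarrow> 0))"

definition directionally_linearly_open ::
  "('a::real_normed_vector \<Rightarrow> 'b::real_normed_vector set) \<Rightarrow> 'a \<Rightarrow> 'b \<Rightarrow> 'b \<Rightarrow> real \<Rightarrow> bool" where
  "directionally_linearly_open F x y u \<alpha> \<longleftrightarrow>
     (x, y) \<in> graph_sv F \<and> \<alpha> > 0 \<and>
     (\<exists>\<epsilon>>0. \<forall>\<rho>\<in>{0<..<\<epsilon>}.
        ball y (\<alpha> * \<rho>) \<inter> {y - t *\<^sub>R u |t. t \<ge> 0} \<subseteq> (\<Union>x'\<in>ball x \<rho>. F x'))"

definition lifted_graph :: "('i::finite \<Rightarrow> 'a \<Rightarrow> 'b set) \<Rightarrow> 'i \<Rightarrow> ('a \<times> ('b ^ 'i)) set" where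
  "lifted_graph F i = {(x, y). y $ i \<in> F i x}"

text \<open>The sum is the Minkowski sum of sets, as in \<open>Set_Algebras\<close>.\<close>

definition sum_map :: "('i::finite \<Rightarrow> 'a \<Rightarrow> 'b::real_normed_vector set) \<Rightarrow> 'a \<Rightarrow> 'b set" where
  "sum_map F x = (\<Sum>i\<in>UNIV. F i x)"

definition finite_dimensional :: "'a::real_vector itself \<Rightarrow> bool" where
  "finite_dimensional _ \<longleftrightarrow> (\<exists>B :: 'a set. finite B \<and> span B = UNIV)"

end

theory Submission
  imports Defs
begin

text \<open>
  A normal to the \<open>i\<close>-th lifted graph only involves \<open>x\<close> and \<open>y\<^sub>i\<close>, so the coderivative hypothesis
  says: for Frechet normals \<open>n\<^sub>i\<close> to the graphs at nearby points there is a bounded velocity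
  \<open>(\<xi>, \<eta>\<^sub>1, \<dots>, \<eta>\<^sub>p)\<close> with \<open>\<parallel>\<xi>\<parallel> \<le> 1 / a\<close>, \<open>\<Sum> \<eta>\<^sub>i = - u\<close> and
  \<open>\<Sum> \<langle>n\<^sub>i, (\<xi>, \<eta>\<^sub>i)\<rangle> \<le> 0\<close>. Along the Euler polygon which takes for \<open>n\<^sub>i\<close> the residual of the Euclidean
  projection of \<open>(x, y\<^sub>i)\<close> onto the \<open>i\<close>-th graph, the sum of the squared distances to the graphs
  grows only by \<open>O(h\<^sup>2)\<close> in a step of length \<open>h\<close>. As \<open>h\<close> tends to \<open>0\<close>, the end points at time \<open>t\<close>
  accumulate at a point of all the graphs with \<open>\<parallel>x - x\<^sub>0\<parallel> \<le> t / a\<close> and with sum displaced by \<open>- t u\<close>.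
\<close>

subsection \<open>Finite-dimensional normed spaces\<close>

text \<open>A convergent sequence is bounded, and any subsequential limit must be its limit. This
  turns the Bolzano-Weierstrass property of a span into closedness, both inside the next induction
  and after it.\<close>

lemma closed_if_bounded_sequences_subconverge:
  fixes S :: "'a::metric_space set"
  assumes "\<And>f :: nat \<Rightarrow> 'a. \<lbrakk>range f \<subseteq> S; bounded (range f)\<rbrakk>
             \<Longrightarrow> \<exists>l\<in>S. \<exists>s. strict_mono s \<and> (f \<circ> s) \<longlonglongrightarrow> l"
  shows "closed S"
  unfolding closed_sequential_limits
proof (intro allI impI)
  fix g l assume g: "(\<forall>n. g n \<in> S) \<and> g \<longlonglongrightarrow> l"
  then obtain l' s where "l' \<in> S" "strict_mono s" "(g \<circ> s) \<longlonglongrightarrow> l'"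
    using assms[of g] convergent_imp_bounded by blast
  with g show "l \<in> S"
    using LIMSEQ_subseq_LIMSEQ LIMSEQ_unique by blast
qed

text \<open>Bolzano-Weierstrass in the given norm, by induction on the spanning set. A vector
  outside the closed span of the others lies at positive distance from it, which bounds its
  coefficients; these subconverge in the reals, and the remainders by induction.\<close>

lemma span_bounded_sequence_subseq:
  fixes B :: "'a::real_normed_vector set" and f :: "nat \<Rightarrow> 'a"
  assumes "finite B" and "range f \<subseteq> span B" and "bounded (range f)"
  shows "\<exists>l\<in>span B. \<exists>s. strict_mono s \<and> (f \<circ> s) \<longlonglongrightarrow> l"
  using assms
proof (induction B arbitrary: f rule: finite_induct)
  case empty
  then have "f = (\<lambda>_. 0)" by auto
  then show ?case
    by (auto intro!: exI[of _ id] simp: strict_mono_id o_def)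
next
  case (insert v B)
  show ?case
  proof (cases "v \<in> span B")
    case True
    then show ?thesis
      using insert.IH[of f] insert.prems by (simp add: span_redundant)
  next
    case False
    \<comment> \<open>Closedness of the smaller span comes from the induction hypothesis itself,
      which is why the induction runs over all sequences \<open>f\<close>.\<close>
    have cl: "closed (span B)"
      using insert.IH by (rule closed_if_bounded_sequences_subconverge)
    define d where "d = infdist v (span B)"
    have ne: "span B \<noteq> {}" using span_zero by blast
    have d: "d > 0"
      using in_closed_iff_infdist_zero[OF cl ne] False infdist_nonneg[of v "span B"]
      unfolding d_def by fastforce
    have "\<forall>n. \<exists>k. f n - k *\<^sub>R v \<in> span B"
      using insert.prems(1) span_breakdown_eq[of _ v B] by blast
    then obtain k where k: "\<And>n. f n - k n *\<^sub>R v \<in> span B" by metis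
    \<comment> \<open>For \<open>k n \<noteq> 0\<close> the vector \<open>v - f n / k n\<close> lies
      in \<open>span B\<close>, so its distance to \<open>v\<close>, the norm of
      \<open>f n / k n\<close>, is at least \<open>d\<close>.\<close>
    have kb: "\<bar>k n\<bar> * d \<le> norm (f n)" for n
    proof (cases "k n = 0")
      case False
      have "(- inverse (k n)) *\<^sub>R (f n - k n *\<^sub>R v) \<in> span B"
        by (rule span_scale[OF k])
      then have "d \<le> dist v ((- inverse (k n)) *\<^sub>R (f n - k n *\<^sub>R v))"
        unfolding d_def by (rule infdist_le)
      also have "\<dots> = norm (inverse (k n) *\<^sub>R f n)"
        using False by (simp add: dist_norm scaleR_diff_right)
      finally show ?thesis using False by (simp add: field_simps)
    qed simp
    obtain M where M: "\<And>n. norm (f n) \<le> M"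
      using insert.prems(2) by (auto simp: bounded_iff)
    have kM: "\<bar>k n\<bar> \<le> M / d" for n
      using kb[of n] M[of n] d by (simp add: field_simps)
    \<comment> \<open>Two extractions follow: \<open>s\<close> makes the coefficients converge, and
      \<open>s'\<close>, taken along \<open>s\<close>, the remainders \<open>g\<close>.\<close>
    have "bounded (range k)"
      unfolding bounded_iff using kM by auto
    then obtain k' s where s: "strict_mono s" "(k \<circ> s) \<longlonglongrightarrow> k'"
      using bounded_imp_convergent_subsequence by blast
    define g where "g n = f (s n) - k (s n) *\<^sub>R v" for n
    have "norm (g n) \<le> M + M / d * norm v" for n
      using norm_triangle_ineq4[of "f (s n)" "k (s n) *\<^sub>R v"] M[of "s n"]
        mult_right_mono[OF kM[of "s n"], of "norm v"] unfolding g_def by simp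
    then have "bounded (range g)" unfolding bounded_iff by auto
    moreover have "range g \<subseteq> span B" unfolding g_def using k by auto
    ultimately obtain l s' where l: "l \<in> span B" "strict_mono s'" "(g \<circ> s') \<longlonglongrightarrow> l"
      using insert.IH by blast
    have "(\<lambda>n. (k \<circ> s) (s' n)) \<longlonglongrightarrow> k'"
      using LIMSEQ_subseq_LIMSEQ[OF s(2) l(2)] by (simp add: o_def)
    then have "(\<lambda>n. (g \<circ> s') n + (k \<circ> s) (s' n) *\<^sub>R v) \<longlonglongrightarrow> l + k' *\<^sub>R v"
      by (intro tendsto_intros l)
    then have "(f \<circ> (s \<circ> s')) \<longlonglongrightarrow> l + k' *\<^sub>R v"
      by (simp add: g_def o_def)
    moreover have "l \<in> span (insert v B)"
      using l(1) span_mono[of B "insert v B"] by blast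
    then have "l + k' *\<^sub>R v \<in> span (insert v B)"
      by (intro span_add span_scale) (auto intro: span_base)
    moreover have "strict_mono (s \<circ> s')" by (rule strict_mono_o[OF s(1) l(2)])
    ultimately show ?thesis by blast
  qed
qed

lemma closed_span_finite:
  fixes B :: "'a::real_normed_vector set"
  assumes "finite B" shows "closed (span B)"
  using span_bounded_sequence_subseq[OF assms]
  by (rule closed_if_bounded_sequences_subconverge)

lemma finite_dimensional_bounded_closed_imp_compact:
  fixes S :: "'a::real_normed_vector set"
  assumes "finite_dimensional TYPE('a)" "bounded S" "closed S"
  shows "compact S"
  unfolding compact_def
proof (intro allI impI)
  fix f :: "nat \<Rightarrow> 'a" assume f: "\<forall>n. f n \<in> S"
  obtain B :: "'a set" where "finite B" "span B = UNIV"
    using assms(1) unfolding finite_dimensional_def by blast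
  moreover have "bounded (range f)" using f assms(2) by (meson bounded_subset image_subsetI)
  ultimately obtain l s where "strict_mono s" "(f \<circ> s) \<longlonglongrightarrow> l"
    using span_bounded_sequence_subseq[of B f] by auto
  moreover have "l \<in> S"
    by (rule closed_sequentially[OF assms(3) _ calculation(2)]) (use f in simp)
  ultimately show "\<exists>l\<in>S. \<exists>s. strict_mono s \<and> (f \<circ> s) \<longlonglongrightarrow> l" by blast
qed

lemma finite_dimensional_prod:
  assumes "finite_dimensional TYPE('a::real_normed_vector)"
    and "finite_dimensional TYPE('b::real_normed_vector)"
  shows "finite_dimensional TYPE('a \<times> 'b)"
proof -
  obtain A :: "'a set" and B :: "'b set"
    where A: "finite A" "span A = UNIV" and B: "finite B" "span B = UNIV"
    using assms unfolding finite_dimensional_def by blast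
  define C where "C = (\<lambda>x. (x, 0::'b)) ` A \<union> (\<lambda>y. (0::'a, y)) ` B"
  have lin: "linear (\<lambda>x. (x, 0::'b))" "linear (\<lambda>y. (0::'a, y))"
    by (auto intro!: linearI)
  have "range (\<lambda>x. (x, 0::'b)) = span ((\<lambda>x. (x, 0)) ` A)"
    unfolding linear_span_image[OF lin(1)] A(2) ..
  moreover have "range (\<lambda>y. (0::'a, y)) = span ((\<lambda>y. (0, y)) ` B)"
    unfolding linear_span_image[OF lin(2)] B(2) ..
  ultimately have "range (\<lambda>x. (x, 0::'b)) \<subseteq> span C" "range (\<lambda>y. (0::'a, y)) \<subseteq> span C"
    unfolding C_def by (simp_all add: span_mono)
  then have "(x, 0) + (0, y) \<in> span C" for x y
    by (intro span_add) auto
  then have "span C = UNIV" by auto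
  moreover have "finite C" unfolding C_def using A(1) B(1) by simp
  ultimately show ?thesis unfolding finite_dimensional_def by blast
qed

lemma finite_dimensional_vec:
  assumes "finite_dimensional TYPE('b::real_normed_vector)"
  shows "finite_dimensional TYPE('b ^ 'n::finite)"
proof -
  obtain B :: "'b set" where B: "finite B" "span B = UNIV"
    using assms unfolding finite_dimensional_def by blast
  define C where "C = (\<Union>i::'n. axis i ` B)"
  have ax: "axis i y \<in> span C" for i y
  proof -
    have "linear (axis i :: 'b \<Rightarrow> 'b ^ 'n)"
      by (auto intro!: linearI simp: axis_def vec_eq_iff)
    then have "range (axis i) = span (axis i ` B)"
      using B(2) linear_span_image[of "axis i :: 'b \<Rightarrow> 'b ^ 'n" B] by simp
    also have "\<dots> \<subseteq> span C" unfolding C_def by (intro span_mono) blast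
    finally show ?thesis by blast
  qed
  have "y \<in> span C" for y :: "'b ^ 'n"
  proof -
    have "y = (\<Sum>i\<in>UNIV. axis i (y $ i))"
      by (simp add: vec_eq_iff axis_def)
    also have "\<dots> \<in> span C" by (intro span_sum ax)
    finally show ?thesis .
  qed
  then have "span C = UNIV" by auto
  moreover have "finite C" unfolding C_def using B(1) by simp
  ultimately show ?thesis unfolding finite_dimensional_def by blast
qed

text \<open>Coordinates with respect to a basis are continuous: the functional of a basis vector
  \<open>b\<close> has norm at most \<open>1 / d\<close>, where \<open>d\<close> is the distance of
  \<open>b\<close> to the span of the other basis vectors, positive because that span is
  closed.\<close>

lemma finite_dimensional_bounded_coordinates:
  assumes "finite_dimensional TYPE('a::real_normed_vector)"
  obtains B :: "'a::real_normed_vector set" and \<phi> :: "'a \<Rightarrow> 'a \<Rightarrow>\<^sub>L real"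
  where "finite B" "\<And>x. x = (\<Sum>b\<in>B. \<phi> b x *\<^sub>R b)"
proof -
  obtain A :: "'a set" where A: "finite A" "span A = UNIV"
    using assms unfolding finite_dimensional_def by blast
  obtain B where B: "B \<subseteq> A" "independent B" "A \<subseteq> span B"
    using maximal_independent_subset by blast
  have fin: "finite B" using A(1) B(1) finite_subset by blast
  have sp: "span B = UNIV" using A(2) B(3) span_mono span_span by (metis top.extremum_uniqueI)
  have bl: "bounded_linear (\<lambda>x. representation B x b)" if b: "b \<in> B" for b
  proof -
    define d where "d = infdist b (span (B - {b}))"
    have "b \<notin> span (B - {b})" using B(2) b dependent_def by blast
    moreover have "span (B - {b}) \<noteq> {}" using span_zero by blast
    ultimately have d: "d > 0"
      using in_closed_iff_infdist_zero[of "span (B - {b})" b] closed_span_finite[of "B - {b}"]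
        fin infdist_nonneg[of b "span (B - {b})"] unfolding d_def by fastforce
    have bound: "\<bar>representation B x b\<bar> \<le> norm x * (1 / d)" for x
    proof (cases "representation B x b = 0")
      case False
      let ?k = "representation B x b"
      have "x = (\<Sum>v\<in>B. representation B x v *\<^sub>R v)"
        using sum_representation_eq[of B x B] B(2) sp fin by simp
      also have "\<dots> = ?k *\<^sub>R b + (\<Sum>v\<in>B-{b}. representation B x v *\<^sub>R v)"
        using fin b by (simp add: sum.remove)
      finally have "x - ?k *\<^sub>R b = (\<Sum>v\<in>B-{b}. representation B x v *\<^sub>R v)"
        by (simp add: algebra_simps)
      also have "\<dots> \<in> span (B - {b})" by (intro span_sum span_scale span_base)
      finally have "(- inverse ?k) *\<^sub>R (x - ?k *\<^sub>R b) \<in> span (B - {b})" by (rule span_scale)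
      then have "d \<le> dist b ((- inverse ?k) *\<^sub>R (x - ?k *\<^sub>R b))"
        unfolding d_def by (rule infdist_le)
      also have "\<dots> = norm (inverse ?k *\<^sub>R x)"
        using False by (simp add: dist_norm scaleR_diff_right)
      finally show ?thesis using False d by (simp add: field_simps)
    qed (use d in simp)
    show ?thesis
    proof (rule bounded_linear_intro)
      show "norm (representation B x b) \<le> norm x * (1 / d)" for x using bound by simp
    qed (use B(2) sp in \<open>simp_all add: representation_add representation_scale\<close>)
  qed
  define \<phi> where "\<phi> b = Blinfun (\<lambda>x. representation B x b)" for b
  have "x = (\<Sum>b\<in>B. \<phi> b x *\<^sub>R b)" for x
    using sum_representation_eq[of B x B] B(2) sp fin bl
    by (simp add: \<phi>_def bounded_linear_Blinfun_apply)
  with fin that show thesis by blast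
qed

text \<open>The given norm need not be differentiable, but the squared distance in an equivalent
  Euclidean norm is, which makes nearest points produce Frechet normals.\<close>

lemma finite_dimensional_inner_product:
  assumes "finite_dimensional TYPE('a::real_normed_vector)"
  obtains J :: "'a::real_normed_vector \<Rightarrow>\<^sub>L 'a \<Rightarrow>\<^sub>L real" and m :: real
  where "\<And>x y. J x y = J y x" "m > 0" "\<And>x. (norm x)\<^sup>2 \<le> m * J x x"
proof -
  obtain B :: "'a set" and \<phi> :: "'a \<Rightarrow> 'a \<Rightarrow>\<^sub>L real"
    where B: "finite B" "\<And>x. x = (\<Sum>b\<in>B. \<phi> b x *\<^sub>R b)"
    using finite_dimensional_bounded_coordinates[OF assms] by blast
  have bl: "bounded_linear (\<lambda>x. \<Sum>b\<in>B. \<phi> b x *\<^sub>R \<phi> b)"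
    by (intro bounded_linear_sum bounded_linear_intros)
  \<comment> \<open>The inner product for which the basis \<open>B\<close> is orthonormal.\<close>
  define J where "J = Blinfun (\<lambda>x. \<Sum>b\<in>B. \<phi> b x *\<^sub>R \<phi> b)"
  have J: "J x y = (\<Sum>b\<in>B. \<phi> b x * \<phi> b y)" for x y
    unfolding J_def bounded_linear_Blinfun_apply[OF bl]
    by (simp add: blinfun.sum_left blinfun.scaleR_left)
  \<comment> \<open>Cauchy-Schwarz gives the sum of squared norms as constant; adding 1 keeps
    \<open>m\<close> positive when the space is trivial and \<open>B\<close> is empty.\<close>
  define m where "m = 1 + (\<Sum>b\<in>B. (norm b)\<^sup>2)"
  have "(norm x)\<^sup>2 \<le> m * J x x" for x
  proof -
    have "norm x \<le> (\<Sum>b\<in>B. \<bar>\<phi> b x\<bar> * norm b)"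
      by (subst B(2)) (rule order_trans[OF norm_sum], simp)
    then have "(norm x)\<^sup>2 \<le> (\<Sum>b\<in>B. \<bar>\<phi> b x\<bar> * norm b)\<^sup>2"
      by (intro power_mono) auto
    also have "\<dots> \<le> (\<Sum>b\<in>B. \<bar>\<phi> b x\<bar>\<^sup>2) * (\<Sum>b\<in>B. (norm b)\<^sup>2)"
      by (rule Cauchy_Schwarz_ineq_sum)
    also have "\<dots> \<le> (\<Sum>b\<in>B. \<bar>\<phi> b x\<bar>\<^sup>2) * m"
      unfolding m_def by (intro mult_left_mono sum_nonneg) auto
    also have "\<dots> = m * J x x" unfolding J by (simp add: power2_eq_square)
    finally show ?thesis .
  qed
  moreover have "m > 0" unfolding m_def by (intro add_pos_nonneg sum_nonneg) auto
  moreover have "J x y = J y x" for x y unfolding J by (simp add: mult.commute)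
  ultimately show thesis using that by blast
qed


subsection \<open>Proximal normals\<close>

text \<open>The quadratic bound is asked on all of \<open>S\<close>. A bound near \<open>x\<close>
  would give it with a larger \<open>K\<close>, since \<open>n\<close> grows only linearly; nearest
  points give the global form directly.\<close>

definition proximal_normal :: "'a::real_normed_vector set \<Rightarrow> 'a \<Rightarrow> ('a \<Rightarrow>\<^sub>L real) \<Rightarrow> bool" where
  "proximal_normal S x n \<longleftrightarrow>
     x \<in> S \<and> (\<exists>K\<ge>0. \<forall>z\<in>S. n (z - x) \<le> K * (norm (z - x))\<^sup>2)"

lemma proximal_normal_scaleR:
  assumes "proximal_normal S x n" "s \<ge> 0"
  shows "proximal_normal S x (s *\<^sub>R n)"
proof -
  obtain K where K: "K \<ge> 0" "\<And>z. z \<in> S \<Longrightarrow> n (z - x) \<le> K * (norm (z - x))\<^sup>2"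
    using assms(1) unfolding proximal_normal_def by blast
  have "(s *\<^sub>R n) (z - x) \<le> (s * K) * (norm (z - x))\<^sup>2" if "z \<in> S" for z
    using mult_left_mono[OF K(2)[OF that] assms(2)] by (simp add: blinfun.scaleR_left mult.assoc)
  then show ?thesis
    using assms K(1) unfolding proximal_normal_def by (metis mult_nonneg_nonneg)
qed

text \<open>Dividing the quadratic bound by \<open>norm (z - x)\<close> leaves
  \<open>K * norm (z - x)\<close>, which tends to 0.\<close>

lemma proximal_normal_in_frechet_normal_cone:
  assumes "proximal_normal S x n"
  shows "n \<in> frechet_normal_cone S x"
proof -
  obtain K where K: "K \<ge> 0" "\<And>z. z \<in> S \<Longrightarrow> n (z - x) \<le> K * (norm (z - x))\<^sup>2" and x: "x \<in> S"
    using assms unfolding proximal_normal_def by blast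
  have "Limsup (at x within S) (\<lambda>z. ereal (n (z - x) / norm (z - x))) \<le> 0 + ereal e"
    if e: "e > 0" for e
  proof (rule Limsup_bounded)
    show "\<forall>\<^sub>F z in at x within S. ereal (n (z - x) / norm (z - x)) \<le> 0 + ereal e"
      unfolding eventually_at
    \<comment> \<open>The radius uses \<open>K + 1\<close> because \<open>K\<close> may be
      0.\<close>
    proof (intro exI[of _ "e / (K + 1)"] conjI ballI impI)
      fix z assume z: "z \<in> S" "z \<noteq> x \<and> dist z x < e / (K + 1)"
      then have pos: "norm (z - x) > 0" by simp
      have "n (z - x) / norm (z - x) \<le> K * norm (z - x)"
        using K(2)[OF z(1)] pos by (simp add: field_simps power2_eq_square)
      also have "\<dots> \<le> (K + 1) * norm (z - x)" by (simp add: algebra_simps)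
      also have "\<dots> \<le> e" using z(2) K(1) by (simp add: dist_norm field_simps)
      finally show "ereal (n (z - x) / norm (z - x)) \<le> 0 + ereal e" by simp
    qed (use e K(1) in auto)
  qed
  then show ?thesis
    using x ereal_le_epsilon2 unfolding frechet_normal_cone_def by auto
qed

section \<open>Nearest points in the Euclidean structure\<close>

lemma quadratic_expansion:
  fixes J :: "'a::real_normed_vector \<Rightarrow>\<^sub>L 'a \<Rightarrow>\<^sub>L real"
  assumes "\<And>x y. J x y = J y x"
  shows "J (x + y) (x + y) = J x x + 2 * J x y + J y y"
  using assms[of x y] by (simp add: blinfun.add_left blinfun.add_right)

lemma quadratic_form_le:
  fixes J :: "'a::real_normed_vector \<Rightarrow>\<^sub>L 'a \<Rightarrow>\<^sub>L real"
  shows "J x x \<le> norm J * (norm x)\<^sup>2"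
proof -
  have "J x x \<le> norm (J x) * norm x"
    using norm_blinfun[of "J x" x] by simp
  also have "\<dots> \<le> (norm J * norm x) * norm x"
    by (intro mult_right_mono norm_blinfun norm_ge_zero)
  finally show ?thesis by (simp add: power2_eq_square mult.assoc)
qed

text \<open>\<open>J (z - g)\<close> is half the gradient at \<open>z\<close> of the squared
  distance to \<open>g\<close>. Expanding the square at a competitor \<open>h\<close> around
  \<open>g\<close>, minimality bounds the linear term by the quadratic one.\<close>

lemma nearest_point_proximal_normal:
  fixes J :: "'a::real_normed_vector \<Rightarrow>\<^sub>L 'a \<Rightarrow>\<^sub>L real"
  assumes "\<And>x y. J x y = J y x"
    and "g \<in> G" and min: "\<And>h. h \<in> G \<Longrightarrow> J (z - g) (z - g) \<le> J (z - h) (z - h)"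
  shows "proximal_normal G g (J (z - g))"
  unfolding proximal_normal_def
proof (intro conjI exI[of _ "norm J"] ballI)
  fix h assume h: "h \<in> G"
  have "J (z - h) (z - h) = J ((z - g) + (g - h)) ((z - g) + (g - h))" by simp
  also have "\<dots> = J (z - g) (z - g) + 2 * J (z - g) (g - h) + J (g - h) (g - h)"
    by (rule quadratic_expansion[OF assms(1)])
  finally have "2 * J (z - g) (h - g) \<le> J (h - g) (h - g)"
    using min[OF h] by (simp add: blinfun.diff_left blinfun.diff_right)
  moreover have "J (h - g) (h - g) \<le> norm J * (norm (h - g))\<^sup>2"
    by (rule quadratic_form_le)
  \<comment> \<open>The expansion bounds twice the value; nonnegativity of the right-hand side
    allows the factor 2 to be dropped.\<close>
  moreover have "0 \<le> norm J * (norm (h - g))\<^sup>2" by simp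
  ultimately show "J (z - g) (h - g) \<le> norm J * (norm (h - g))\<^sup>2" by linarith
qed (use assms(2) in auto)

lemma nearest_point_exists:
  fixes J :: "'a::real_normed_vector \<Rightarrow>\<^sub>L 'a \<Rightarrow>\<^sub>L real"
  assumes "finite_dimensional TYPE('a)" and "m > 0" and J: "\<And>x. (norm x)\<^sup>2 \<le> m * J x x"
    and G: "closed G" "G \<noteq> {}"
  shows "\<exists>g\<in>G. \<forall>h\<in>G. J (z - g) (z - g) \<le> J (z - h) (z - h)"
proof -
  obtain g0 where g0: "g0 \<in> G" using G by blast
  \<comment> \<open>Every point of \<open>G\<close> at least as \<open>J\<close>-close to
    \<open>z\<close> as \<open>g0\<close> lies in the norm ball of radius \<open>R\<close>, so
    minimising over the compact set \<open>K\<close> suffices.\<close>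
  define R where "R = sqrt (m * J (z - g0) (z - g0))"
  define K where "K = G \<inter> cball z R"
  have inK: "h \<in> K" if h: "h \<in> G" "J (z - h) (z - h) \<le> J (z - g0) (z - g0)" for h
  proof -
    have "(norm (z - h))\<^sup>2 \<le> m * J (z - g0) (z - g0)"
      using J[of "z - h"] mult_left_mono[OF h(2), of m] assms(2) by linarith
    then have "norm (z - h) \<le> R" unfolding R_def by (rule real_le_rsqrt)
    then show ?thesis using h unfolding K_def by (simp add: dist_norm)
  qed
  have "compact K"
    using assms(1) unfolding K_def
    by (rule finite_dimensional_bounded_closed_imp_compact) (use G in auto)
  moreover have "K \<noteq> {}" using inK[OF g0] by auto
  moreover have "continuous_on K (\<lambda>g. J (z - g) (z - g))"
    by (intro continuous_intros)
  ultimately have "\<exists>g\<in>K. \<forall>h\<in>K. J (z - g) (z - g) \<le> J (z - h) (z - h)"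
    by (rule continuous_attains_inf)
  then obtain g where g: "g \<in> K" "\<And>h. h \<in> K \<Longrightarrow> J (z - g) (z - g) \<le> J (z - h) (z - h)"
    by blast
  show ?thesis
  proof (intro bexI[of _ g] ballI)
    fix h assume h: "h \<in> G"
    show "J (z - g) (z - g) \<le> J (z - h) (z - h)"
    proof (cases "J (z - h) (z - h) \<le> J (z - g0) (z - g0)")
      case True
      then show ?thesis using g(2) inK[OF h] by blast
    next
      case False
      then show ?thesis using g(2)[OF inK[OF g0]] by simp
    qed
  qed (use g in \<open>auto simp: K_def\<close>)
qed

section \<open>Descent velocities for families of normals\<close>

lemma blinfun_apply_if:
  "blinfun_apply L (if b then x else 0) = (if b then L x else 0)"
  by simp

text \<open>The gap between \<open>a\<close> and \<open>c\<close> makes \<open>norm L\<close> exceed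
  \<open>a * l\<close>, so some \<open>v\<close> satisfies
  \<open>\<bar>L v\<bar> > a * l * norm v\<close>. Rescaling it to the value \<open>- l\<close>
  gives norm at most \<open>1 / a\<close>, and the norm of \<open>L\<close> need not be
  attained.\<close>

lemma blinfun_descent_vector:
  fixes L :: "'a::real_normed_vector \<Rightarrow>\<^sub>L real"
  assumes "0 < a" "a < c" "0 < l" "c * l \<le> norm L"
  obtains x where "norm x \<le> 1 / a" "L x = - l"
proof -
  have "\<not> norm L \<le> a * l"
    using mult_strict_right_mono[OF assms(2,3)] assms(4) by linarith
  moreover have al: "0 \<le> a * l" using assms by simp
  ultimately obtain v where "\<not> norm (L v) \<le> a * l * norm v"
    using norm_blinfun_bound[of "a * l" L] by blast
  then have v: "a * l * norm v < \<bar>L v\<bar>" by simp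
  then have nz: "L v \<noteq> 0"
    using mult_nonneg_nonneg[OF al norm_ge_zero[of v]] by linarith
  define x where "x = (- l / L v) *\<^sub>R v"
  have "L x = - l" using nz unfolding x_def by (simp add: blinfun.scaleR_right blinfun.minus_right)
  moreover have "norm x \<le> 1 / a"
  proof -
    have "norm x = l * norm v / \<bar>L v\<bar>" using assms(3) unfolding x_def by simp
    also have "\<dots> \<le> 1 / a"
      using v nz assms(1) by (simp add: divide_le_eq le_divide_eq mult.commute mult.left_commute)
    finally show ?thesis .
  qed
  ultimately show thesis using that by blast
qed

text \<open>With \<open>y\<^sup>* = - ws one\<close> and \<open>z\<^sub>i\<^sup>* = ws i - ws one\<close>, homogeneity removes the normalisation
  \<open>\<langle>y\<^sup>*, u\<rangle> = 1\<close>. If some \<open>z\<^sub>j\<^sup>*\<close> is too large, moving mass from \<open>\<eta> one\<close> to \<open>\<eta> j\<close> already gives descent.\<close>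

lemma descent_direction:
  fixes xs :: "'p::finite \<Rightarrow> 'x::real_normed_vector \<Rightarrow>\<^sub>L real"
    and ws :: "'p \<Rightarrow> 'y::real_normed_vector \<Rightarrow>\<^sub>L real"
  assumes a: "0 < a" "a < c"
    and hyp: "\<lbrakk>ws one u < 0; \<And>i. i \<noteq> one \<Longrightarrow> norm (ws i - ws one) < 2 * c * (- ws one u)\<rbrakk>
               \<Longrightarrow> c * (- ws one u) \<le> norm (\<Sum>i\<in>UNIV. xs i)"
  shows "\<exists>\<xi> \<eta>. norm \<xi> \<le> 1 / a \<and> (\<forall>i. norm (\<eta> i) \<le> norm u + 1 / a) \<and>
           (\<Sum>i\<in>UNIV. \<eta> i) = - u \<and> (\<Sum>i\<in>UNIV. xs i \<xi> + ws i (\<eta> i)) \<le> 0"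
proof -
  \<comment> \<open>The basic velocity puts the whole displacement \<open>- u\<close> on the index
    \<open>one\<close>; its cost is \<open>- ws one u\<close>, which one of the three cases below
    shows to be nonpositive or compensates.\<close>
  define \<delta> :: "'p \<Rightarrow> 'y" where "\<delta> = (\<lambda>i. if i = one then - u else 0)"
  have \<delta>: "norm (\<delta> i) \<le> norm u + 1 / a" "(\<Sum>i\<in>UNIV. \<delta> i) = - u"
    "(\<Sum>i\<in>UNIV. ws i (\<delta> i)) = - ws one u" for i
    using a unfolding \<delta>_def by (simp_all add: blinfun_apply_if blinfun.minus_right)
  consider "ws one u \<ge> 0"
    | "ws one u < 0" "\<And>i. i \<noteq> one \<Longrightarrow> norm (ws i - ws one) < 2 * c * (- ws one u)"
    | j where "ws one u < 0" "j \<noteq> one" "2 * c * (- ws one u) \<le> norm (ws j - ws one)"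
    using not_le by blast
  then show ?thesis
  proof cases
    case 1
    then show ?thesis using \<delta> a by (intro exI[of _ 0] exI[of _ \<delta>] conjI allI) simp_all
  next
    case 2
    \<comment> \<open>The motion \<open>\<xi>\<close> in \<open>x\<close> contributes exactly
      \<open>ws one u\<close>, cancelling the cost of \<open>\<delta>\<close>.\<close>
    obtain \<xi> where "norm \<xi> \<le> 1 / a" "(\<Sum>i\<in>UNIV. xs i) \<xi> = - (- ws one u)"
      by (rule blinfun_descent_vector[OF a _ hyp[OF 2]]) (use 2(1) in auto)
    then show ?thesis
      using \<delta> by (intro exI[of _ \<xi>] exI[of _ \<delta>] conjI allI) (simp_all add: sum.distrib blinfun.sum_left)
  next
    case 3
    have le: "c * (- ws one u) \<le> norm (ws j - ws one)"
      using mult_pos_pos[of c "- ws one u"] 3(1,3) a by linarith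
    obtain y where y: "norm y \<le> 1 / a" "(ws j - ws one) y = - (- ws one u)"
      by (rule blinfun_descent_vector[OF a _ le]) (use 3(1) in auto)
    \<comment> \<open>Adding \<open>y\<close> at \<open>j\<close> and subtracting it at
      \<open>one\<close> preserves the sum and contributes \<open>(ws j - ws one) y\<close>, which
      cancels the cost of \<open>\<delta>\<close> with \<open>x\<close> at rest.\<close>
    define \<eta> where "\<eta> i = \<delta> i + ((if i = j then y else 0) + (if i = one then - y else 0))" for i
    have "norm (\<eta> i) \<le> norm u + 1 / a" for i
      using y(1) 3(2) norm_triangle_ineq4[of "- u" y] norm_ge_zero[of u] a
      unfolding \<eta>_def \<delta>_def by (auto simp del: norm_ge_zero)
    moreover have "(\<Sum>i\<in>UNIV. \<eta> i) = - u"
      unfolding \<eta>_def by (simp add: sum.distrib \<delta>)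
    moreover have "(\<Sum>i\<in>UNIV. ws i (\<eta> i)) = - ws one u + (ws j - ws one) y"
      unfolding \<eta>_def
      by (simp add: sum.distrib \<delta> blinfun.add_right blinfun.diff_left blinfun.minus_right
          blinfun_apply_if)
    ultimately show ?thesis
      using y a by (intro exI[of _ 0] exI[of _ \<eta>] conjI allI) simp_all
  qed
qed

subsection \<open>Euler polygons with proximal aiming\<close>

lemma dual_pair_apply [simp]: "dual_pair xs ys (x, y) = xs x + ys y"
  by (simp add: dual_pair_def blinfun.add_left fst_blinfun.rep_eq snd_blinfun.rep_eq)

lemma dual_pair_scaleR: "s *\<^sub>R dual_pair xs ys = dual_pair (s *\<^sub>R xs) (s *\<^sub>R ys)"
  by (rule blinfun_eqI) (auto simp: blinfun.scaleR_left distrib_left)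

lemma dual_pair_cases:
  fixes n :: "('a::real_normed_vector \<times> 'b::real_normed_vector) \<Rightarrow>\<^sub>L real"
  shows "\<exists>xs ys. n = dual_pair xs ys"
proof -
  have "bounded_linear (\<lambda>x. n (x, 0))" "bounded_linear (\<lambda>y. n (0, y))"
    by (intro bounded_linear_compose[OF blinfun.bounded_linear_right] bounded_linear_Pair
        bounded_linear_ident bounded_linear_zero)+
  then have "n = dual_pair (Blinfun (\<lambda>x. n (x, 0))) (Blinfun (\<lambda>y. n (0, y)))"
    by (intro blinfun_eqI)
      (auto simp: bounded_linear_Blinfun_apply blinfun.add_right[symmetric])
  then show ?thesis by blast
qed

text \<open>Triangle inequality through \<open>z\<close>; the factor
  \<open>sqrt (m * norm J)\<close> is the distortion between the given norm and the norm of
  \<open>J\<close>, in which \<open>g\<close> is at least as close to \<open>z\<close> as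
  \<open>b\<close> is.\<close>

lemma nearest_point_norm_le:
  fixes J :: "'a::real_normed_vector \<Rightarrow>\<^sub>L 'a \<Rightarrow>\<^sub>L real"
  assumes "m > 0" and J: "\<And>x. (norm x)\<^sup>2 \<le> m * J x x"
    and le: "J (z - g) (z - g) \<le> J (z - b) (z - b)"
  shows "norm (g - b) \<le> (1 + sqrt (m * norm J)) * norm (z - b)"
proof -
  have "(norm (z - g))\<^sup>2 \<le> m * J (z - g) (z - g)" by (rule J)
  also have "\<dots> \<le> m * (norm J * (norm (z - b))\<^sup>2)"
    using order_trans[OF le quadratic_form_le] assms(1) by simp
  also have "\<dots> = (sqrt (m * norm J) * norm (z - b))\<^sup>2"
    using assms(1) by (simp add: power_mult_distrib)
  finally have "norm (z - g) \<le> sqrt (m * norm J) * norm (z - b)"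
    by (rule power2_le_imp_le) (use assms(1) in simp)
  moreover have "norm (g - b) \<le> norm (z - b) + norm (z - g)"
    using norm_triangle_ineq4[of "z - b" "z - g"] by simp
  ultimately show ?thesis by (simp add: algebra_simps)
qed

text \<open>The Euler polygon argument for arbitrary closed sets coupled only through the common
  \<open>x\<close>. \<open>A\<close> and \<open>K\<close> bound the speeds in \<open>x\<close> and
  in each \<open>y i\<close>, and \<open>dir\<close> supplies a velocity that does not increase the
  summed squared distances to first order.\<close>

lemma proximal_aiming:
  fixes G :: "'p::finite \<Rightarrow> ('x::real_normed_vector \<times> 'y::real_normed_vector) set"
    and x0 :: 'x and y0 :: "'p \<Rightarrow> 'y" and u :: 'y
  assumes fd: "finite_dimensional TYPE('x)" "finite_dimensional TYPE('y)"
    and cl: "\<And>i. closed (G i)" and base: "\<And>i. (x0, y0 i) \<in> G i"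
    and AK: "A \<ge> 0" "K \<ge> 0" and r: "r > 0"
    and dir: "\<And>g n. \<lbrakk>\<And>i. norm (g i - (x0, y0 i)) < r; \<And>i. proximal_normal (G i) (g i) (n i)\<rbrakk>
      \<Longrightarrow> \<exists>\<xi> \<eta>. norm \<xi> \<le> A \<and> (\<forall>i. norm (\<eta> i) \<le> K) \<and> (\<Sum>i\<in>UNIV. \<eta> i) = - u \<and>
                (\<Sum>i\<in>UNIV. blinfun_apply (n i) (\<xi>, \<eta> i)) \<le> 0"
  shows "\<exists>\<epsilon>>0. \<forall>t\<in>{0..<\<epsilon>}. \<exists>x y. (\<forall>i. (x, y i) \<in> G i) \<and> norm (x - x0) \<le> t * A \<and>
           (\<Sum>i\<in>UNIV. y i) = (\<Sum>i\<in>UNIV. y0 i) - t *\<^sub>R u"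
proof -
  obtain J :: "('x \<times> 'y) \<Rightarrow>\<^sub>L ('x \<times> 'y) \<Rightarrow>\<^sub>L real" and m :: real
    where sym: "\<And>x y. J x y = J y x" and m: "m > 0" and J: "\<And>x. (norm x)\<^sup>2 \<le> m * J x x"
    using finite_dimensional_inner_product[OF finite_dimensional_prod[OF fd]] by blast
  \<comment> \<open>\<open>R\<close> bounds the speed of each pair \<open>(x, y i)\<close>,
    \<open>D\<close> the distortion of the projection, and \<open>E\<close> the second-order error
    of a step relative to \<open>h\<^sup>2\<close>. Before time \<open>\<epsilon>\<close> the
    projections stay in the balls where \<open>dir\<close> applies; \<open>R + 1\<close> avoids a
    zero denominator.\<close>
  define R where "R = A + K"
  define D where "D = 1 + sqrt (m * norm J)"
  define E where "E = real CARD('p) * (norm J * R\<^sup>2)"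
  define \<epsilon> where "\<epsilon> = r / (D * (R + 1))"
  have R: "R \<ge> 0" using AK unfolding R_def by simp
  have D: "D > 0" using m unfolding D_def by (simp add: add_pos_nonneg)
  have E: "E \<ge> 0" unfolding E_def by simp
  have \<epsilon>: "\<epsilon> > 0" using r D R unfolding \<epsilon>_def by simp
  \<comment> \<open>Invariant at time \<open>s\<close>: speed bounds, exact displacement of the sum,
    and points \<open>g i\<close> of the sets witnessing total squared distance at most
    \<open>\<delta>\<close>.\<close>
  define P where "P s \<delta> x y g \<longleftrightarrow> norm (x - x0) \<le> s * A \<and> (\<forall>i. norm (y i - y0 i) \<le> s * K) \<and>
      (\<Sum>i\<in>UNIV. y i) = (\<Sum>i\<in>UNIV. y0 i) - s *\<^sub>R u \<and> (\<forall>i. g i \<in> G i) \<and>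
      (\<Sum>i\<in>UNIV. J ((x, y i) - g i) ((x, y i) - g i)) \<le> \<delta>" for s \<delta> x y g
  have step: "\<exists>x' y' g'. P (s + h) (\<delta> + h\<^sup>2 * E) x' y' g'"
    if P: "P s \<delta> x y g" and s: "s < \<epsilon>" "0 \<le> s" and h: "0 \<le> h" for s \<delta> h x y g
  proof -
    \<comment> \<open>The old witnesses \<open>g\<close> are replaced by nearest points
      \<open>g'\<close>, whose residuals are no longer and are proximal normals through
      \<open>J\<close>.\<close>
    have "\<forall>i. \<exists>g\<in>G i. \<forall>h\<in>G i. J ((x, y i) - g) ((x, y i) - g) \<le> J ((x, y i) - h) ((x, y i) - h)"
      using nearest_point_exists[OF finite_dimensional_prod[OF fd] m J cl] base by blast
    then obtain g' where g': "\<And>i. g' i \<in> G i"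
      and min: "\<And>i h. h \<in> G i \<Longrightarrow>
        J ((x, y i) - g' i) ((x, y i) - g' i) \<le> J ((x, y i) - h) ((x, y i) - h)"
      by metis
    define n where "n i = (x, y i) - g' i" for i
    have "norm (g' i - (x0, y0 i)) < r" for i
    proof -
      have "norm ((x, y i) - (x0, y0 i)) \<le> norm (x - x0) + norm (y i - y0 i)"
        using norm_Pair_le[of "x - x0" "y i - y0 i"] by simp
      also have "\<dots> \<le> s * R"
        using P unfolding P_def R_def by (simp add: distrib_left add_mono)
      finally have "D * norm ((x, y i) - (x0, y0 i)) \<le> D * (s * R)"
        using D by simp
      moreover have "norm (g' i - (x0, y0 i)) \<le> D * norm ((x, y i) - (x0, y0 i))"
        unfolding D_def by (rule nearest_point_norm_le[OF m J min[OF base]])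
      moreover have "D * (s * R) \<le> s * (D * (R + 1))"
        using D s by (simp add: algebra_simps)
      moreover have "s * (D * (R + 1)) < r"
        using s(1) D R unfolding \<epsilon>_def by (simp add: pos_less_divide_eq)
      ultimately show ?thesis by linarith
    qed
    moreover have "proximal_normal (G i) (g' i) (J (n i))" for i
      unfolding n_def by (rule nearest_point_proximal_normal[OF sym g' min])
    ultimately obtain \<xi> \<eta> where \<xi>: "norm \<xi> \<le> A" and \<eta>: "\<And>i. norm (\<eta> i) \<le> K"
      and sum: "(\<Sum>i\<in>UNIV. \<eta> i) = - u" and desc: "(\<Sum>i\<in>UNIV. J (n i) (\<xi>, \<eta> i)) \<le> 0"
      using dir[of g' "\<lambda>i. J (n i)"] by blast
    define x' where "x' = x + h *\<^sub>R \<xi>"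
    define y' where "y' i = y i + h *\<^sub>R \<eta> i" for i
    have "norm (x' - x0) \<le> (s + h) * A"
    proof -
      have "norm (x' - x0) \<le> norm (x - x0) + norm (h *\<^sub>R \<xi>)"
        unfolding x'_def using norm_triangle_ineq[of "x - x0" "h *\<^sub>R \<xi>"] by (simp add: algebra_simps)
      also have "\<dots> \<le> s * A + h * A"
        using P h mult_left_mono[OF \<xi> h] unfolding P_def by simp
      finally show ?thesis by (simp add: algebra_simps)
    qed
    moreover have "norm (y' i - y0 i) \<le> (s + h) * K" for i
    proof -
      have "norm (y' i - y0 i) \<le> norm (y i - y0 i) + norm (h *\<^sub>R \<eta> i)"
        unfolding y'_def using norm_triangle_ineq[of "y i - y0 i" "h *\<^sub>R \<eta> i"]
        by (simp add: algebra_simps)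
      also have "\<dots> \<le> s * K + h * K"
        using P h mult_left_mono[OF \<eta> h] unfolding P_def by (intro add_mono) simp_all
      finally show ?thesis by (simp add: algebra_simps)
    qed
    moreover have "(\<Sum>i\<in>UNIV. y' i) = (\<Sum>i\<in>UNIV. y0 i) - (s + h) *\<^sub>R u"
      using P sum unfolding P_def y'_def
      by (simp add: sum.distrib scaleR_sum_right[symmetric] algebra_simps)
    moreover have "(\<Sum>i\<in>UNIV. J ((x', y' i) - g' i) ((x', y' i) - g' i)) \<le> \<delta> + h\<^sup>2 * E"
    proof -
      \<comment> \<open>The new position is measured against the old projection \<open>g'\<close>,
        so its residual is the old one plus \<open>h\<close> times the velocity.\<close>
      have eq: "(x', y' i) - g' i = n i + h *\<^sub>R (\<xi>, \<eta> i)" for i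
        unfolding x'_def y'_def n_def by (cases "g' i") simp
      have "J ((x', y' i) - g' i) ((x', y' i) - g' i) \<le>
          J ((x, y i) - g i) ((x, y i) - g i) + 2 * h * J (n i) (\<xi>, \<eta> i) + h\<^sup>2 * (norm J * R\<^sup>2)"
        for i
      proof -
        have "norm (\<xi>, \<eta> i) \<le> R"
          using norm_Pair_le[of \<xi> "\<eta> i"] \<xi> \<eta>[of i] unfolding R_def by linarith
        then have "norm J * (norm (\<xi>, \<eta> i))\<^sup>2 \<le> norm J * R\<^sup>2"
          by (intro mult_left_mono power_mono) auto
        then have "J (\<xi>, \<eta> i) (\<xi>, \<eta> i) \<le> norm J * R\<^sup>2"
          using quadratic_form_le[of J "(\<xi>, \<eta> i)"] by linarith
        then have "h\<^sup>2 * J (\<xi>, \<eta> i) (\<xi>, \<eta> i) \<le> h\<^sup>2 * (norm J * R\<^sup>2)"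
          by (rule mult_left_mono) simp
        moreover have "J (n i) (n i) \<le> J ((x, y i) - g i) ((x, y i) - g i)"
          unfolding n_def using min P unfolding P_def by blast
        moreover have "J (n i + h *\<^sub>R (\<xi>, \<eta> i)) (n i + h *\<^sub>R (\<xi>, \<eta> i)) =
            J (n i) (n i) + 2 * h * J (n i) (\<xi>, \<eta> i) + h\<^sup>2 * J (\<xi>, \<eta> i) (\<xi>, \<eta> i)"
          unfolding quadratic_expansion[OF sym] blinfun.scaleR_right blinfun.scaleR_left
          by (simp add: power2_eq_square)
        ultimately show ?thesis unfolding eq by linarith
      qed
      then have "(\<Sum>i\<in>UNIV. J ((x', y' i) - g' i) ((x', y' i) - g' i)) \<le>
          (\<Sum>i\<in>UNIV. J ((x, y i) - g i) ((x, y i) - g i) + 2 * h * J (n i) (\<xi>, \<eta> i)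
            + h\<^sup>2 * (norm J * R\<^sup>2))"
        by (intro sum_mono)
      also have "\<dots> = (\<Sum>i\<in>UNIV. J ((x, y i) - g i) ((x, y i) - g i))
          + 2 * h * (\<Sum>i\<in>UNIV. J (n i) (\<xi>, \<eta> i)) + h\<^sup>2 * E"
        unfolding E_def sum.distrib sum_distrib_left[symmetric] by simp
      \<comment> \<open>The first-order term is nonpositive by the choice of velocity; only the
        quadratic error remains.\<close>
      also have "\<dots> \<le> \<delta> + 0 + h\<^sup>2 * E"
        using P desc h unfolding P_def
        by (intro add_mono) (auto intro: mult_nonneg_nonpos)
      finally show ?thesis by simp
    qed
    ultimately have "P (s + h) (\<delta> + h\<^sup>2 * E) x' y' g'"
      using g' unfolding P_def by blast
    then show ?thesis by blast
  qed
  have "\<exists>x y. (\<forall>i. (x, y i) \<in> G i) \<and> norm (x - x0) \<le> t * A \<and>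
          (\<Sum>i\<in>UNIV. y i) = (\<Sum>i\<in>UNIV. y0 i) - t *\<^sub>R u"
    if t: "0 \<le> t" "t < \<epsilon>" for t
  proof -
    \<comment> \<open>\<open>Suc N\<close> equal steps of length \<open>t / Suc N\<close> accumulate
      an error \<open>Suc N * h\<^sup>2 * E\<close>, which is \<open>t\<^sup>2 * E / Suc N\<close>
      and vanishes as \<open>N\<close> grows.\<close>
    have approx: "\<exists>x y g. P t (t\<^sup>2 * E * inverse (real (Suc N))) x y g" for N
    proof -
      define h where "h = t / real (Suc N)"
      have h: "0 \<le> h" unfolding h_def using t by simp
      have "\<exists>x y g. P (real k * h) (real k * (h\<^sup>2 * E)) x y g" if "k \<le> Suc N" for k
        using that
      proof (induction k)
        case 0
        have "P 0 0 x0 y0 (\<lambda>i. (x0, y0 i))" unfolding P_def using base by (simp add: zero_prod_def[symmetric])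
        then show ?case by auto
      next
        case (Suc k)
        then obtain x y g where "P (real k * h) (real k * (h\<^sup>2 * E)) x y g" by auto
        moreover have "real k * h \<le> t"
        proof -
          have "real k * h \<le> real (Suc N) * h" using Suc.prems h by (intro mult_right_mono) auto
          then show ?thesis unfolding h_def by simp
        qed
        ultimately have "\<exists>x y g. P (real k * h + h) (real k * (h\<^sup>2 * E) + h\<^sup>2 * E) x y g"
          using step h t by simp
        moreover have "real k * h + h = real (Suc k) * h"
          "real k * (h\<^sup>2 * E) + h\<^sup>2 * E = real (Suc k) * (h\<^sup>2 * E)"
          by (simp_all add: algebra_simps)
        ultimately show ?case by simp
      qed
      from this[of "Suc N"] have "\<exists>x y g. P (real (Suc N) * h) (real (Suc N) * (h\<^sup>2 * E)) x y g"
        by blast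
      moreover have "real (Suc N) * h = t" unfolding h_def by simp
      moreover have "real (Suc N) * (h\<^sup>2 * E) = t\<^sup>2 * E * inverse (real (Suc N))"
        unfolding h_def by (simp add: power_divide power2_eq_square field_simps del: of_nat_Suc)
      ultimately show ?thesis by (simp only:)
    qed
    then obtain X Y g where XYg: "\<And>N. P t (t\<^sup>2 * E * inverse (real (Suc N))) (X N) (Y N) (g N)"
      by metis
    \<comment> \<open>Collecting the end points in one vector lets a single compactness argument
      extract a subsequence common to all coordinates.\<close>
    define f where "f N = (X N, \<chi> i. Y N i)" for N
    define S where "S = cball (x0, \<chi> i. y0 i) (t * A + (\<Sum>i\<in>(UNIV :: 'p set). t * K))"
    have "f N \<in> S" for N
    proof -
      have "norm (f N - (x0, \<chi> i. y0 i)) \<le> norm (X N - x0) + norm ((\<chi> i. Y N i) - (\<chi> i. y0 i))"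
        unfolding f_def using norm_Pair_le[of "X N - x0"] by simp
      also have "norm ((\<chi> i. Y N i) - (\<chi> i. y0 i)) \<le> (\<Sum>i\<in>UNIV. norm (Y N i - y0 i))"
        unfolding norm_vec_def using L2_set_le_sum[of UNIV "\<lambda>i. norm (Y N i - y0 i)"] by simp
      also have "\<dots> \<le> (\<Sum>i\<in>(UNIV :: 'p set). t * K)"
        using XYg[of N] unfolding P_def by (intro sum_mono) blast
      also have "norm (X N - x0) \<le> t * A" using XYg[of N] unfolding P_def by blast
      finally show ?thesis unfolding S_def by (simp add: dist_norm norm_minus_commute)
    qed
    moreover have "compact S"
      using finite_dimensional_prod[OF fd(1) finite_dimensional_vec[OF fd(2)]]
      unfolding S_def by (intro finite_dimensional_bounded_closed_imp_compact) auto
    ultimately obtain l \<sigma> where \<sigma>: "strict_mono \<sigma>" and l: "(f \<circ> \<sigma>) \<longlonglongrightarrow> l"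
      unfolding compact_def by blast
    have lx: "(\<lambda>k. X (\<sigma> k)) \<longlonglongrightarrow> fst l"
      using tendsto_fst[OF l] by (simp add: f_def o_def)
    have ly: "(\<lambda>k. Y (\<sigma> k) i) \<longlonglongrightarrow> snd l $ i" for i
      using tendsto_vec_nth[OF tendsto_snd[OF l], of i] by (simp add: f_def o_def)
    \<comment> \<open>The residuals \<open>w\<close> tend to 0, so the witnesses in the closed set
      \<open>G i\<close> share the limit of the end points.\<close>
    have "(fst l, snd l $ i) \<in> G i" for i
    proof -
      define w where "w N = (X N, Y N i) - g N i" for N
      have bound: "(norm (w N))\<^sup>2 \<le> m * (t\<^sup>2 * E * inverse (real (Suc N)))" for N
      proof -
        have nonneg: "0 \<le> J v v" for v
          using order_trans[OF zero_le_power2 J[of v]] m by (simp add: zero_le_mult_iff)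
        have "J (w N) (w N) \<le> (\<Sum>i\<in>UNIV. J ((X N, Y N i) - g N i) ((X N, Y N i) - g N i))"
          unfolding w_def by (rule member_le_sum) (use nonneg in auto)
        also have "\<dots> \<le> t\<^sup>2 * E * inverse (real (Suc N))"
          using XYg[of N] unfolding P_def by blast
        finally have "m * J (w N) (w N) \<le> m * (t\<^sup>2 * E * inverse (real (Suc N)))"
          using m by simp
        then show ?thesis using J[of "w N"] by linarith
      qed
      have "(\<lambda>N. m * (t\<^sup>2 * E * inverse (real (Suc N)))) \<longlonglongrightarrow> m * (t\<^sup>2 * E * 0)"
        by (intro tendsto_mult tendsto_const LIMSEQ_inverse_real_of_nat)
      then have "(\<lambda>N. m * (t\<^sup>2 * E * inverse (real (Suc N)))) \<longlonglongrightarrow> 0"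
        by simp
      then have "(\<lambda>N. (norm (w N))\<^sup>2) \<longlonglongrightarrow> 0"
        by (rule tendsto_sandwich[OF _ _ tendsto_const, rotated -1])
          (use bound in \<open>auto intro!: always_eventually simp del: of_nat_Suc\<close>)
      then have "(\<lambda>N. sqrt ((norm (w N))\<^sup>2)) \<longlonglongrightarrow> sqrt 0"
        by (rule tendsto_real_sqrt)
      then have "w \<longlonglongrightarrow> 0" by (simp add: tendsto_norm_zero_iff)
      then have "(\<lambda>k. (X (\<sigma> k), Y (\<sigma> k) i) - w (\<sigma> k)) \<longlonglongrightarrow> (fst l, snd l $ i) - 0"
        using LIMSEQ_subseq_LIMSEQ[OF _ \<sigma>, of w 0]
        by (intro tendsto_diff tendsto_Pair lx ly) (simp add: o_def)
      then have "(\<lambda>k. g (\<sigma> k) i) \<longlonglongrightarrow> (fst l, snd l $ i)" by (simp add: w_def)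
      moreover have "g (\<sigma> k) i \<in> G i" for k using XYg[of "\<sigma> k"] unfolding P_def by blast
      ultimately show ?thesis by (rule closed_sequentially[OF cl[of i], rotated])
    qed
    moreover have "norm (fst l - x0) \<le> t * A"
    proof (rule LIMSEQ_le_const2)
      show "(\<lambda>k. norm (X (\<sigma> k) - x0)) \<longlonglongrightarrow> norm (fst l - x0)"
        by (intro tendsto_intros lx)
      show "\<exists>N. \<forall>k\<ge>N. norm (X (\<sigma> k) - x0) \<le> t * A"
        using XYg unfolding P_def by blast
    qed
    moreover have "(\<Sum>i\<in>UNIV. snd l $ i) = (\<Sum>i\<in>UNIV. y0 i) - t *\<^sub>R u"
    proof (rule LIMSEQ_unique)
      show "(\<lambda>k. \<Sum>i\<in>UNIV. Y (\<sigma> k) i) \<longlonglongrightarrow> (\<Sum>i\<in>UNIV. snd l $ i)"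
        by (intro tendsto_sum ly)
      have "(\<Sum>i\<in>UNIV. Y (\<sigma> k) i) = (\<Sum>i\<in>UNIV. y0 i) - t *\<^sub>R u" for k
        using XYg[of "\<sigma> k"] unfolding P_def by blast
      then show "(\<lambda>k. \<Sum>i\<in>UNIV. Y (\<sigma> k) i) \<longlonglongrightarrow> (\<Sum>i\<in>UNIV. y0 i) - t *\<^sub>R u"
        by simp
    qed
    ultimately show ?thesis
      by (intro exI[of _ "fst l"] exI[of _ "\<lambda>i. snd l $ i"]) blast
  qed
  with \<epsilon> show ?thesis by (intro exI[of _ \<epsilon>]) simp
qed

section \<open>Openness of the sum mapping\<close>

(* The index set {1,...,p} is the finite type 'p, with one as the index 1. *)
theorem theorem4p5:
  fixes F :: "'p::finite \<Rightarrow> 'x::real_normed_vector \<Rightarrow> 'y::real_normed_vector set"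
    and one :: 'p
    and xbar :: 'x and ybar :: "'p \<Rightarrow> 'y" and u :: 'y
    and c r :: real
  assumes "finite_dimensional TYPE('x)" and "finite_dimensional TYPE('y)"
    and "\<And>i. closed (graph_sv (F i))"
    and "\<And>i. (xbar, ybar i) \<in> graph_sv (F i)"
    and "u \<in> sphere 0 1"
    and "allied (lifted_graph F) (xbar, \<chi> i. ybar i)"
    and "c > 0" and "r > 0"
    and "\<And>(us :: 'p \<Rightarrow> 'x) (vs :: 'p \<Rightarrow> 'y) (ystar :: 'y \<Rightarrow>\<^sub>L real)
          (zstar :: 'p \<Rightarrow> ('y \<Rightarrow>\<^sub>L real)) (xstar :: 'p \<Rightarrow> ('x \<Rightarrow>\<^sub>L real)).
          \<lbrakk>\<And>i. (us i, vs i) \<in> graph_sv (F i) \<inter> (ball xbar r \<times> ball (ybar i) r);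
           blinfun_apply ystar u = 1;
           \<And>i. i \<noteq> one \<Longrightarrow> zstar i \<in> ball 0 (2 * c);
           xstar one \<in> frechet_coderivative (F one) (us one) (vs one) ystar;
           \<And>i. i \<noteq> one \<Longrightarrow>
              xstar i \<in> frechet_coderivative (F i) (us i) (vs i) (ystar - zstar i)\<rbrakk>
          \<Longrightarrow> c \<le> norm (\<Sum>i\<in>UNIV. xstar i)"
  shows "\<forall>a\<in>{0<..<c}.
           directionally_linearly_open (sum_map F) xbar (\<Sum>i\<in>UNIV. ybar i) u a"
proof
  fix a assume "a \<in> {0<..<c}"
  then have a: "0 < a" "a < c" by auto
  have u: "norm u = 1" using assms(5) by simp
  \<comment> \<open>Proximal aiming is applied to the graphs with \<open>A = 1 / a\<close> and
    \<open>K = norm u + 1 / a\<close>, the speeds provided by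
    \<open>descent_direction\<close>.\<close>
  have "\<exists>\<epsilon>>0. \<forall>t\<in>{0..<\<epsilon>}. \<exists>x y. (\<forall>i. (x, y i) \<in> graph_sv (F i)) \<and>
          norm (x - xbar) \<le> t * (1 / a) \<and>
          (\<Sum>i\<in>UNIV. y i) = (\<Sum>i\<in>UNIV. ybar i) - t *\<^sub>R u"
  proof (rule proximal_aiming[OF assms(1-4) _ _ assms(8)])
    fix g :: "'p \<Rightarrow> 'x \<times> 'y" and n :: "'p \<Rightarrow> ('x \<times> 'y) \<Rightarrow>\<^sub>L real"
    assume g: "\<And>i. norm (g i - (xbar, ybar i)) < r"
      and n: "\<And>i. proximal_normal (graph_sv (F i)) (g i) (n i)"
    have "\<forall>i. \<exists>xs ws. n i = dual_pair xs ws" by (simp add: dual_pair_cases)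
    then obtain xs ws where n_eq: "\<And>i. n i = dual_pair (xs i) (ws i)" by metis
    have "\<exists>\<xi> \<eta>. norm \<xi> \<le> 1 / a \<and> (\<forall>i. norm (\<eta> i) \<le> norm u + 1 / a) \<and>
            (\<Sum>i\<in>UNIV. \<eta> i) = - u \<and> (\<Sum>i\<in>UNIV. xs i \<xi> + ws i (\<eta> i)) \<le> 0"
    proof (rule descent_direction[OF a, where one = one])
      assume neg: "ws one u < 0"
        and small: "\<And>i. i \<noteq> one \<Longrightarrow> norm (ws i - ws one) < 2 * c * (- ws one u)"
      \<comment> \<open>Division by \<open>l\<close> normalises \<open>ystar u\<close> to 1 and
        keeps the normals proximal. The signs are chosen so that \<open>ystar - zstar i\<close>
        equals \<open>- ws i / l\<close>, the argument at which \<open>xs i / l\<close> is a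
        coderivative element.\<close>
      define l where "l = - ws one u"
      have l: "l > 0" using neg unfolding l_def by simp
      define ystar where "ystar = - (inverse l *\<^sub>R ws one)"
      define zstar where "zstar i = inverse l *\<^sub>R (ws i - ws one)" for i
      define xstar where "xstar i = inverse l *\<^sub>R xs i" for i
      have cod: "xstar i \<in> frechet_coderivative (F i) (fst (g i)) (snd (g i)) y"
        if "y = - (inverse l *\<^sub>R ws i)" for i y
        using proximal_normal_in_frechet_normal_cone[OF proximal_normal_scaleR[OF n, of "inverse l" i]]
          l that
        unfolding frechet_coderivative_def xstar_def by (simp add: n_eq dual_pair_scaleR)
      have "c \<le> norm (\<Sum>i\<in>UNIV. xstar i)"
      proof (rule assms(9)[where us = "\<lambda>i. fst (g i)" and vs = "\<lambda>i. snd (g i)"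
              and ystar = ystar and zstar = zstar])
        fix i
        show "(fst (g i), snd (g i)) \<in> graph_sv (F i) \<inter> (ball xbar r \<times> ball (ybar i) r)"
          using n[of i] g[of i] norm_fst_le[of "fst (g i) - xbar" "snd (g i) - ybar i"]
            norm_snd_le[of "snd (g i) - ybar i" "fst (g i) - xbar"]
          unfolding proximal_normal_def
          by (cases "g i") (simp add: dist_norm norm_minus_commute)
      next
        show "ystar u = 1"
          using l unfolding ystar_def l_def by (simp add: blinfun.minus_left blinfun.scaleR_left)
      next
        fix i assume "i \<noteq> one"
        then have "norm (ws i - ws one) < 2 * c * l" using small unfolding l_def by blast
        moreover have "norm (zstar i) = norm (ws i - ws one) / l"
          using l unfolding zstar_def by (simp add: divide_inverse)
        ultimately show "zstar i \<in> ball 0 (2 * c)"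
          using l by (simp add: pos_divide_less_eq)
        show "xstar i \<in> frechet_coderivative (F i) (fst (g i)) (snd (g i)) (ystar - zstar i)"
          by (rule cod) (simp add: ystar_def zstar_def scaleR_diff_right)
      next
        show "xstar one \<in> frechet_coderivative (F one) (fst (g one)) (snd (g one)) ystar"
          by (rule cod) (simp add: ystar_def)
      qed
      also have "(\<Sum>i\<in>UNIV. xstar i) = inverse l *\<^sub>R (\<Sum>i\<in>UNIV. xs i)"
        unfolding xstar_def by (simp add: scaleR_sum_right)
      finally show "c * (- ws one u) \<le> norm (\<Sum>i\<in>UNIV. xs i)"
        using l unfolding l_def[symmetric] by (simp add: field_simps)
    qed
    then show "\<exists>\<xi> \<eta>. norm \<xi> \<le> 1 / a \<and> (\<forall>i. norm (\<eta> i) \<le> norm u + 1 / a) \<and>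
        (\<Sum>i\<in>UNIV. \<eta> i) = - u \<and> (\<Sum>i\<in>UNIV. n i (\<xi>, \<eta> i)) \<le> 0"
      by (simp add: n_eq)
  qed (use a in auto)
  then obtain \<epsilon> where \<epsilon>: "\<epsilon> > 0" and traj: "\<And>t. \<lbrakk>0 \<le> t; t < \<epsilon>\<rbrakk> \<Longrightarrow>
      \<exists>x y. (\<forall>i. (x, y i) \<in> graph_sv (F i)) \<and> norm (x - xbar) \<le> t * (1 / a) \<and>
          (\<Sum>i\<in>UNIV. y i) = (\<Sum>i\<in>UNIV. ybar i) - t *\<^sub>R u"
    by (metis atLeastLessThan_iff)
  have sumI: "(\<Sum>i\<in>UNIV. y i) \<in> sum_map F x" if "\<And>i. (x, y i) \<in> graph_sv (F i)" for x y
    using that unfolding sum_map_def graph_sv_def by (auto simp: set_sum_alt)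
  show "directionally_linearly_open (sum_map F) xbar (\<Sum>i\<in>UNIV. ybar i) u a"
    unfolding directionally_linearly_open_def
  \<comment> \<open>Radii below \<open>\<epsilon> / a\<close> keep the times
    \<open>t < a * \<rho>\<close> below \<open>\<epsilon>\<close>.\<close>
  proof (intro conjI exI[of _ "\<epsilon> / a"] ballI subsetI)
    show "(xbar, \<Sum>i\<in>UNIV. ybar i) \<in> graph_sv (sum_map F)"
      using sumI[of xbar ybar] assms(4) by (simp add: graph_sv_def)
  next
    fix \<rho> v
    assume \<rho>: "\<rho> \<in> {0<..<\<epsilon> / a}"
      and v: "v \<in> ball (\<Sum>i\<in>UNIV. ybar i) (a * \<rho>) \<inter> {(\<Sum>i\<in>UNIV. ybar i) - t *\<^sub>R u |t. t \<ge> 0}"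
    then obtain t where t: "t \<ge> 0" "v = (\<Sum>i\<in>UNIV. ybar i) - t *\<^sub>R u" by blast
    \<comment> \<open>As \<open>u\<close> is a unit vector, \<open>t\<close> is the distance of
      \<open>v\<close> from the centre. The trajectory for time \<open>t\<close> reaches
      \<open>v\<close> with \<open>x\<close> moved by at most \<open>t / a < \<rho>\<close>.\<close>
    then have "t < a * \<rho>" using v u by (simp add: dist_norm)
    moreover have "a * \<rho> < \<epsilon>" using \<rho> a by (simp add: field_simps)
    ultimately obtain x y where xy: "\<And>i. (x, y i) \<in> graph_sv (F i)" "norm (x - xbar) \<le> t * (1 / a)"
        "(\<Sum>i\<in>UNIV. y i) = v"
      using traj[of t] t by auto
    have "t * (1 / a) < \<rho>" using \<open>t < a * \<rho>\<close> a by (simp add: field_simps)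
    then have "x \<in> ball xbar \<rho>" using xy(2) by (simp add: dist_norm norm_minus_commute)
    then show "v \<in> (\<Union>x'\<in>ball xbar \<rho>. sum_map F x')"
      using sumI[OF xy(1)] xy(3) by auto
  qed (use a \<epsilon> in auto)
qed

end
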